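(* Let $K\subseteq\mathbb{R}^{n+m}$ be a compact regular partially convex set. The completion of the space $\mathcal{P}_{\mathrm{aff}}(K)$ of partially affine polynomials with respect to the supremum norm on $K$ is the space $\mathcal{C}_{\mathrm{aff}}(K)$ of continuous partially affine functions. That is, $\overline{\mathcal{P}_{\mathrm{aff}}(K)}=\mathcal{C}_{\mathrm{aff}}(K)$.
   Context: Elements of $\mathbb{R}^{n+m}$ are written $(x,y)$ with $x\in\mathbb{R}^n$, $y\in\mathbb{R}^m$; $\pi_2(K)=\{y\in\mathbb{R}^m:\exists x,\ (x,y)\in K\}$ and $K_y=\{x\in\mathbb{R}^n:(x,y)\in K\}$. A closed set $K\subset\mathbb{R}^{n+m}$ is a regular partially convex set if (1) $K_y$ is convex for all $y\in\pi_2(K)$; (2) the interior $\operatorname{int}(K_y)$ in $\mathbb{R}^n$ is nonempty for all $y\in\pi_2(K)$; (3) the set-valued map $y\mapsto\operatorname{int}(K_y)$ on $\pi_2(K)$ is lower hemicontinuous: for every $y\in\pi_2(K)$, every sequence $y_k\to y$ in $\pi_2(K)$ and every $x\in\operatorname{int}(K_y)$ there are $x_k\in\operatorname{int}(K_{y_k})$ with $x_k\to x$. $\mathcal{P}_{\mathrm{aff}}(K)$ consists of the real polynomials $p(x,y)=\sum_{i=1}^n c_i(y)x_i+c_0(y)$ with $c_i$ polynomials in $y$, regarded as functions on $K$. $\mathcal{C}_{\mathrm{aff}}(K)$ consists of the continuous $f:K\to\mathbb{R}$ such that for each fixed $y$ the function $x\mapsto f(x,y)$ is affine on $K_y$. The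 norm is $\|f\|_\infty=\sup_{z\in K}|f(z)|$, and the closure is taken in the continuous functions on $K$ with this norm. *)

theory Defs
  imports "HOL-Analysis.Analysis"
begin

text \<open>A subset \<open>K\<close> of $R^{n+m}$ is a set of pairs \<open>(x, y)\<close> with
  \<open>x :: real ^ 'n\<close> and \<open>y :: real ^ 'm\<close>.\<close>

definition proj2 :: "((real ^ 'n) \<times> (real ^ 'm)) set \<Rightarrow> (real ^ 'm) set" where
  "proj2 K = {y. \<exists>x. (x, y) \<in> K}"

definition fiber :: "((real ^ 'n) \<times> (real ^ 'm)) set \<Rightarrow> real ^ 'm \<Rightarrow> (real ^ 'n) set" where
  "fiber K y = {x. (x, y) \<in> K}"

definition lower_hemicontinuous_on ::
    "'b::topological_space set \<Rightarrow> ('b \<Rightarrow> 'a::topological_space set) \<Rightarrow> bool" where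
  "lower_hemicontinuous_on S F \<longleftrightarrow>
     (\<forall>y\<in>S. \<forall>ys :: nat \<Rightarrow> 'b. (\<forall>k. ys k \<in> S) \<longrightarrow> ys \<longlonglongrightarrow> y \<longrightarrow>
        (\<forall>x \<in> F y. \<exists>xs :: nat \<Rightarrow> 'a. (\<forall>k. xs k \<in> F (ys k)) \<and> xs \<longlonglongrightarrow> x))"

definition regular_partially_convex :: "((real ^ 'n) \<times> (real ^ 'm)) set \<Rightarrow> bool" where
  "regular_partially_convex K \<longleftrightarrow>
     closed K \<and>
     (\<forall>y \<in> proj2 K. convex (fiber K y)) \<and>
     (\<forall>y \<in> proj2 K. interior (fiber K y) \<noteq> {}) \<and>
     lower_hemicontinuous_on (proj2 K) (\<lambda>y. interior (fiber K y))"

text \<open>Functions on \<open>K\<close> are extensional (\<open>undefined\<close> outside \<open>K\<close>), so that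
  equality of functions is equality on \<open>K\<close>, as in \<^const>\<open>cfunspace\<close>.\<close>

definition paff_polys :: "((real ^ 'n) \<times> (real ^ 'm)) set \<Rightarrow> ((real ^ 'n) \<times> (real ^ 'm) \<Rightarrow> real) set" where
  "paff_polys K =
     {restrict (\<lambda>(x, y). (\<Sum>i\<in>UNIV. c i y * x $ i) + c0 y) K | c c0.
        (\<forall>i. real_polynomial_function (c i)) \<and> real_polynomial_function c0}"

text \<open>A real function on a convex set is affine if it preserves convex combinations.\<close>

definition affine_on :: "'a::real_vector set \<Rightarrow> ('a \<Rightarrow> real) \<Rightarrow> bool" where
  "affine_on C f \<longleftrightarrow>
     (\<forall>a\<in>C. \<forall>b\<in>C. \<forall>t\<in>{0..1}. f ((1 - t) *\<^sub>R a + t *\<^sub>R b) = (1 - t) * f a + t * f b)"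

definition paff_continuous :: "((real ^ 'n) \<times> (real ^ 'm)) set \<Rightarrow> ((real ^ 'n) \<times> (real ^ 'm) \<Rightarrow> real) set" where
  "paff_continuous K =
     {f \<in> extensional K. continuous_on K f \<and> (\<forall>y \<in> proj2 K. affine_on (fiber K y) (\<lambda>x. f (x, y)))}"

definition sup_metric :: "'a::topological_space set \<Rightarrow> ('a \<Rightarrow> real) metric" where
  "sup_metric K = cfunspace (top_of_set K) euclidean_metric"

text \<open>For compact \<open>K\<close> this is the space of all continuous real functions on \<open>K\<close> with the
  metric induced by the supremum norm.\<close>

lemma mspace_sup_metric:
  assumes "compact K"
  shows "mspace (sup_metric K) = {f \<in> extensional K. continuous_on K f}"
  using assms by (auto simp: sup_metric_def compactin_mspace_cfunspace compactin_subtopology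
      simp del: mspace_cfunspace)

lemma mdist_sup_metric:
  assumes "f \<in> mspace (sup_metric K)" "g \<in> mspace (sup_metric K)" "K \<noteq> {}"
  shows "mdist (sup_metric K) f g = (SUP z\<in>K. \<bar>f z - g z\<bar>)"
proof -
  have "f \<in> mspace (funspace K euclidean_metric)" "g \<in> mspace (funspace K euclidean_metric)"
    using assms cfunspace_subset_funspace[of "top_of_set K" "euclidean_metric :: real metric"]
    by (auto simp: sup_metric_def simp del: mspace_cfunspace mspace_funspace)
  then show ?thesis
    using assms(3)
    by (simp add: sup_metric_def mdist_cfunspace_eq_mdist_funspace Met_TC.fdist_def dist_real_def)
qed

end

theory Submission
  imports Defs
begin

text \<open>A function that is affine on a convex set with nonempty interior is the restriction of an
  affine function on the whole space, so a continuous partially affine \<open>f\<close> has the form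
  \<open>f (x, y) = a y \<bullet> x + b y\<close> with unique coefficients (\<open>affine_on_imp_affine_form\<close>). The heart of
  the matter is that \<open>a\<close> and \<open>b\<close> are continuous in \<open>y\<close> (\<open>continuous_on_fiber_coefficients\<close>). They
  are determined by the values of \<open>f\<close> at the vertices of a small simplex inside a fiber. When \<open>y\<close>
  moves to a nearby point, lower hemicontinuity moves this simplex to a nearby one in the nearby
  fiber, and as \<open>f\<close> is continuous on \<open>K\<close>, its values at the vertices change little; hence the
  coefficients change little too. Without lower hemicontinuity the nearby fibers could be thin, and
  slopes across a thin fiber are not controlled by \<open>f\<close>.

  The Stone-Weierstrass theorem on the compact set \<open>proj2 K\<close> now replaces the coefficients by
  polynomials in \<open>y\<close>. The error in \<open>f\<close> stays uniformly small because \<open>x\<close> is bounded on \<open>K\<close>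
  (\<open>paff_polys_dense\<close>). Conversely, being affine on each fiber is a family of linear equations
  between point values, which uniform limits preserve. So the partially affine functions form a
  closed subspace of the complete space of continuous functions, which contains the partially
  affine polynomials; this gives the other inclusion and completeness.\<close>

section \<open>Affine functions on convex sets with nonempty interior\<close>

text \<open>The candidate affine function interpolates \<open>f\<close> at the vertices of a small simplex in \<open>C\<close>. The
  zero set of the difference is convex and contains these vertices, so it has an interior point \<open>z\<close>.
  Every point of \<open>C\<close> is the end of a segment from \<open>z\<close> whose initial part lies in the zero set, and
  an affine function on a segment with two zeros vanishes.\<close>

lemma affine_on_imp_affine_form:
  fixes C :: "'a::euclidean_space set"
  assumes "convex C" "interior C \<noteq> {}" "affine_on C f"
  obtains a b where "\<And>x. x \<in> C \<Longrightarrow> f x = a \<bullet> x + b"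
proof -
  obtain x0 where "x0 \<in> interior C" using assms(2) by blast
  then obtain e where e: "e > 0" "cball x0 e \<subseteq> C"
    by (meson mem_interior_cball)
  define a where "a = (\<Sum>i\<in>Basis. ((f (x0 + e *\<^sub>R i) - f x0) / e) *\<^sub>R i)"
  define b where "b = f x0 - a \<bullet> x0"
  define g where "g x = f x - (a \<bullet> x + b)" for x
  define Z where "Z = {x \<in> C. g x = 0}"
  have aff: "g ((1 - t) *\<^sub>R p + t *\<^sub>R q) = (1 - t) * g p + t * g q"
    if "p \<in> C" "q \<in> C" "t \<in> {0..1}" for p q t
  proof -
    have "f ((1 - t) *\<^sub>R p + t *\<^sub>R q) = (1 - t) * f p + t * f q"
      using assms(3) that unfolding affine_on_def by blast
    then show ?thesis
      unfolding g_def by (simp add: inner_add_right) (simp add: algebra_simps)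
  qed
  have ai: "a \<bullet> i = (f (x0 + e *\<^sub>R i) - f x0) / e" if "i \<in> Basis" for i
    unfolding a_def using that by (simp add: inner_sum_left_Basis)
  have x0Z: "x0 \<in> Z"
    using e by (auto simp: Z_def g_def b_def)
  have iZ: "x0 + e *\<^sub>R i \<in> Z" if "i \<in> Basis" for i
    using e that by (auto simp: Z_def g_def b_def dist_norm inner_add_right ai intro!: subsetD[OF e(2)])
  have "convex Z"
    unfolding convex_alt using aff assms(1) by (auto simp: Z_def convex_alt)
  have "affine hull Z = UNIV"
  proof -
    have "(\<lambda>i. e *\<^sub>R i) ` Basis \<subseteq> (\<lambda>x. - x0 + x) ` Z"
      using iZ by (force simp: image_iff)
    then have "span ((\<lambda>i. e *\<^sub>R i) ` Basis) \<subseteq> span ((\<lambda>x. - x0 + x) ` Z)"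
      by (rule span_mono)
    moreover have "span ((\<lambda>i. e *\<^sub>R i) ` (Basis :: 'a set)) = UNIV"
      using span_image_scale[of "Basis :: 'a set" "\<lambda>_. e"] e by simp
    moreover have "affine hull Z = (\<lambda>x. x0 + x) ` span ((\<lambda>x. - x0 + x) ` Z)"
      using affine_hull_insert_span_gen[of x0 Z] x0Z by (simp add: insert_absorb)
    ultimately show ?thesis
      by (simp add: top.extremum_unique)
  qed
  then have "interior Z \<noteq> {}"
    using rel_interior_interior rel_interior_eq_empty[OF \<open>convex Z\<close>] x0Z by blast
  then obtain z r where z: "r > 0" "cball z r \<subseteq> Z"
    by (meson ex_in_conv mem_interior_cball)
  have "g x = 0" if x: "x \<in> C" for x
  proof -
    \<comment> \<open>small enough for \<open>(1 - t) z + t x\<close> to lie in the ball around \<open>z\<close>, and at most 1\<close>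
    define t where "t = r / (r + norm (x - z))"
    have pos: "r + norm (x - z) > 0" using z by (simp add: add_pos_nonneg)
    have t: "0 < t" "t \<le> 1" using z pos by (auto simp: t_def divide_simps)
    have "t * norm (x - z) \<le> r"
      using z pos unfolding t_def by (simp add: divide_simps algebra_simps)
    then have "dist z ((1 - t) *\<^sub>R z + t *\<^sub>R x) \<le> r"
      using t by (simp add: dist_norm norm_minus_commute algebra_simps
          flip: scaleR_diff_right)
    then have "(1 - t) *\<^sub>R z + t *\<^sub>R x \<in> Z" using z by auto
    moreover have "z \<in> Z" using z by auto
    ultimately show ?thesis
      using aff[of z x t] t x by (auto simp: Z_def)
  qed
  then have "f x = a \<bullet> x + b" if "x \<in> C" for x
    using that by (simp add: g_def)
  then show thesis by (rule that)
qed

text \<open>Inner products with an exact basis bound \<open>u\<close> by the 1-norm. For a basis that is only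
  nearly right, the error is a small multiple of \<open>norm (u k)\<close> and can be absorbed on the left, so no
  boundedness of \<open>u\<close> has to be known beforehand.\<close>

lemma tendsto_zero_if_inner_nearly_Basis:
  fixes u :: "'b \<Rightarrow> 'a::euclidean_space"
  assumes v: "\<And>i. i \<in> Basis \<Longrightarrow> (v i \<longlongrightarrow> i) F"
    and uv: "\<And>i. i \<in> Basis \<Longrightarrow> ((\<lambda>k. u k \<bullet> v i k) \<longlongrightarrow> 0) F"
  shows "(u \<longlongrightarrow> 0) F"
proof (rule Lim_null_comparison)
  have "((\<lambda>k. \<Sum>i\<in>Basis. norm (v i k - i)) \<longlongrightarrow> (\<Sum>i\<in>(Basis::'a set). norm (i - i))) F"
    by (intro tendsto_intros v)
  then have "\<forall>\<^sub>F k in F. (\<Sum>i\<in>Basis. norm (v i k - i)) < 1/2"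
    by (rule order_tendstoD) simp
  then show "\<forall>\<^sub>F k in F. norm (u k) \<le> 2 * (\<Sum>i\<in>Basis. \<bar>u k \<bullet> v i k\<bar>)"
  proof eventually_elim
    case (elim k)
    have "norm (u k) \<le> (\<Sum>i\<in>Basis. \<bar>u k \<bullet> i\<bar>)"
      by (rule norm_le_l1)
    also have "\<dots> \<le> (\<Sum>i\<in>Basis. \<bar>u k \<bullet> v i k\<bar> + norm (u k) * norm (v i k - i))"
    proof (rule sum_mono)
      fix i :: 'a
      have "\<bar>u k \<bullet> i\<bar> \<le> \<bar>u k \<bullet> v i k\<bar> + \<bar>u k \<bullet> (v i k - i)\<bar>"
        by (simp add: inner_diff_right)
      then show "\<bar>u k \<bullet> i\<bar> \<le> \<bar>u k \<bullet> v i k\<bar> + norm (u k) * norm (v i k - i)"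
        using Cauchy_Schwarz_ineq2[of "u k" "v i k - i"] by linarith
    qed
    also have "\<dots> = (\<Sum>i\<in>Basis. \<bar>u k \<bullet> v i k\<bar>) + norm (u k) * (\<Sum>i\<in>Basis. norm (v i k - i))"
      by (simp add: sum.distrib sum_distrib_left)
    also have "\<dots> \<le> (\<Sum>i\<in>Basis. \<bar>u k \<bullet> v i k\<bar>) + norm (u k) * (1/2)"
      using elim by (intro add_left_mono mult_left_mono) auto
    finally show ?case by simp
  qed
  have "((\<lambda>k. 2 * (\<Sum>i\<in>Basis. \<bar>u k \<bullet> v i k\<bar>)) \<longlongrightarrow> 2 * (\<Sum>i\<in>(Basis::'a set). \<bar>0\<bar>)) F"
    by (intro tendsto_intros uv)
  then show "((\<lambda>k. 2 * (\<Sum>i\<in>Basis. \<bar>u k \<bullet> v i k\<bar>)) \<longlongrightarrow> 0) F"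
    by simp
qed

section \<open>Continuity of the coefficients\<close>

text \<open>Let \<open>ys\<close> converge to \<open>y\<close>. Lower hemicontinuity turns the vertices \<open>x0\<close> and \<open>x0 + e i\<close> of a
  simplex in the fiber over \<open>y\<close> into vertices of simplices in the fibers over \<open>ys k\<close>. Their rescaled
  edges \<open>v i k\<close> converge to the basis vectors \<open>i\<close>, and difference quotients of \<open>f\<close> along these edges
  are the products \<open>a (ys k) \<bullet> v i k\<close>, so the previous lemma applies to \<open>a (ys k) - a y\<close>.\<close>

lemma continuous_on_fiber_coefficients:
  fixes K :: "((real ^ 'n) \<times> (real ^ 'm)) set"
  assumes K: "regular_partially_convex K"
    and f: "continuous_on K f"
    and ab: "\<And>x y. (x, y) \<in> K \<Longrightarrow> f (x, y) = a y \<bullet> x + b y"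
  shows "continuous_on (proj2 K) a" and "continuous_on (proj2 K) b"
proof -
  have lim: "(\<lambda>k. a (ys k)) \<longlonglongrightarrow> a y \<and> (\<lambda>k. b (ys k)) \<longlonglongrightarrow> b y"
    if ys: "\<And>k. ys k \<in> proj2 K" "ys \<longlonglongrightarrow> y" and y: "y \<in> proj2 K" for ys y
  proof -
    let ?I = "\<lambda>y. interior (fiber K y)"
    have "\<exists>xs. (\<forall>k. xs k \<in> ?I (ys k)) \<and> xs \<longlonglongrightarrow> x" if "x \<in> ?I y" for x
      using K ys y that unfolding regular_partially_convex_def lower_hemicontinuous_on_def by blast
    then obtain xs where xs: "\<And>x k. x \<in> ?I y \<Longrightarrow> xs x k \<in> ?I (ys k)"
        "\<And>x. x \<in> ?I y \<Longrightarrow> xs x \<longlonglongrightarrow> x"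
      by metis
    have inK: "(x, z) \<in> K" if "x \<in> ?I z" for x z
      using that interior_subset by (auto simp: fiber_def)
    have flim: "(\<lambda>k. f (xs x k, ys k)) \<longlonglongrightarrow> f (x, y)" if x: "x \<in> ?I y" for x
    proof (rule continuous_on_tendsto_compose[OF f])
      show "(\<lambda>k. (xs x k, ys k)) \<longlonglongrightarrow> (x, y)"
        using xs(2)[OF x] ys(2) by (rule tendsto_Pair)
    qed (use x xs(1) inK in auto)
    obtain x0 where "x0 \<in> ?I y"
      using K y unfolding regular_partially_convex_def by blast
    then obtain e where e: "e > 0" "cball x0 e \<subseteq> ?I y"
      using open_contains_cball open_interior by blast
    have x0: "x0 \<in> ?I y" using e by auto
    have xi: "x0 + e *\<^sub>R i \<in> ?I y" if "i \<in> Basis" for i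
      using e that by (intro subsetD[OF e(2)]) (auto simp: dist_norm)
    define v where "v i k = (xs (x0 + e *\<^sub>R i) k - xs x0 k) /\<^sub>R e" for i k
    have v: "v i \<longlonglongrightarrow> i" if i: "i \<in> Basis" for i
    proof -
      have "v i \<longlonglongrightarrow> (x0 + e *\<^sub>R i - x0) /\<^sub>R e"
        unfolding v_def by (intro tendsto_intros xs x0 xi i)
      then show ?thesis using e by simp
    qed
    have "(\<lambda>k. a (ys k) - a y) \<longlonglongrightarrow> 0"
    proof (rule tendsto_zero_if_inner_nearly_Basis[OF v])
      fix i :: "real ^ 'n" assume i: "i \<in> Basis"
      have "(\<lambda>k. (f (xs (x0 + e *\<^sub>R i) k, ys k) - f (xs x0 k, ys k)) / e - a y \<bullet> v i k)
          \<longlonglongrightarrow> (f (x0 + e *\<^sub>R i, y) - f (x0, y)) / e - a y \<bullet> i"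
        using e by (intro tendsto_intros flim x0 xi v i) auto
      moreover have "(f (x0 + e *\<^sub>R i, y) - f (x0, y)) / e - a y \<bullet> i = 0"
        using e ab[OF inK[OF x0]] ab[OF inK[OF xi[OF i]]] by (simp add: inner_add_right)
      moreover have "(f (xs (x0 + e *\<^sub>R i) k, ys k) - f (xs x0 k, ys k)) / e - a y \<bullet> v i k
          = (a (ys k) - a y) \<bullet> v i k" for k
        using e ab[OF inK[OF xs(1)[OF x0]]] ab[OF inK[OF xs(1)[OF xi[OF i]]]]
        by (simp add: v_def inner_diff_left inner_diff_right divide_simps)
      ultimately show "(\<lambda>k. (a (ys k) - a y) \<bullet> v i k) \<longlonglongrightarrow> 0"
        by simp
    qed
    then have alim: "(\<lambda>k. a (ys k)) \<longlonglongrightarrow> a y"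
      by (rule LIM_zero_cancel)
    have "(\<lambda>k. f (xs x0 k, ys k) - a (ys k) \<bullet> xs x0 k) \<longlonglongrightarrow> f (x0, y) - a y \<bullet> x0"
      by (intro tendsto_intros flim alim xs x0)
    then have "(\<lambda>k. b (ys k)) \<longlonglongrightarrow> b y"
      using ab[OF inK[OF x0]] ab[OF inK[OF xs(1)[OF x0]]] by simp
    with alim show ?thesis by blast
  qed
  show "continuous_on (proj2 K) a" "continuous_on (proj2 K) b"
    using lim by (auto intro!: continuous_on_sequentiallyI)
qed

section \<open>Polynomial approximation\<close>

lemma compact_proj2: "compact K \<Longrightarrow> compact (proj2 K)"
proof -
  assume "compact K"
  then have "compact (snd ` K)"
    by (intro compact_continuous_image continuous_intros)
  moreover have "snd ` K = proj2 K" by (force simp: proj2_def)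
  ultimately show ?thesis by simp
qed

text \<open>It suffices to approximate the coefficients: \<open>a\<close> enters \<open>f\<close> only through the product with
  \<open>x\<close>, whose norm is bounded on \<open>K\<close>.\<close>

lemma paff_polys_dense:
  fixes K :: "((real ^ 'n) \<times> (real ^ 'm)) set"
  assumes K: "compact K" "regular_partially_convex K"
    and f: "f \<in> paff_continuous K" and "\<epsilon> > 0"
  obtains p where "p \<in> paff_polys K" "\<And>z. z \<in> K \<Longrightarrow> \<bar>f z - p z\<bar> \<le> \<epsilon>"
proof -
  have "\<exists>a b. \<forall>x\<in>fiber K y. f (x, y) = a \<bullet> x + b" if "y \<in> proj2 K" for y
  proof -
    have "convex (fiber K y)" "interior (fiber K y) \<noteq> {}" "affine_on (fiber K y) (\<lambda>x. f (x, y))"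
      using K f that by (auto simp: regular_partially_convex_def paff_continuous_def)
    from affine_on_imp_affine_form[OF this] show ?thesis by metis
  qed
  then obtain a b where "\<And>x y. y \<in> proj2 K \<Longrightarrow> x \<in> fiber K y \<Longrightarrow> f (x, y) = a y \<bullet> x + b y"
    by metis
  then have ab: "f (x, y) = a y \<bullet> x + b y" if "(x, y) \<in> K" for x y
    using that by (auto simp: proj2_def fiber_def)
  have cont: "continuous_on (proj2 K) a" "continuous_on (proj2 K) b"
    using continuous_on_fiber_coefficients[OF K(2) _ ab] f by (auto simp: paff_continuous_def)
  obtain R where R: "R > 0" "\<And>x y. (x, y) \<in> K \<Longrightarrow> norm x \<le> R"
  proof -
    obtain B where B: "B > 0" "\<And>z. z \<in> K \<Longrightarrow> norm z \<le> B"
      using compact_imp_bounded[OF K(1)] by (auto simp: bounded_pos)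
    have "norm x \<le> B" if "(x, y) \<in> K" for x y
      using norm_fst_le[of x y] B(2)[OF that] by simp
    with B that show thesis by blast
  qed
  \<comment> \<open>each of the \<open>n\<close> linear terms contributes an error of at most \<open>\<delta> R\<close>, the constant term at most \<open>\<delta>\<close>\<close>
  define \<delta> where "\<delta> = \<epsilon> / (CARD('n) * R + 1)"
  have pos: "CARD('n) * R + 1 > 0" using R by (simp add: add_nonneg_pos)
  have \<delta>: "\<delta> > 0" using \<open>\<epsilon> > 0\<close> pos by (simp add: \<delta>_def)
  have "\<exists>c. real_polynomial_function c \<and> (\<forall>y\<in>proj2 K. \<bar>a y $ i - c y\<bar> < \<delta>)" for i
    using Stone_Weierstrass_real_polynomial_function[OF compact_proj2[OF K(1)], of "\<lambda>y. a y $ i" \<delta>]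
      cont(1) \<delta> continuous_on_component by metis
  then obtain c where c: "\<And>i. real_polynomial_function (c i)"
      "\<And>i y. y \<in> proj2 K \<Longrightarrow> \<bar>a y $ i - c i y\<bar> < \<delta>"
    by metis
  obtain c0 where c0: "real_polynomial_function c0" "\<And>y. y \<in> proj2 K \<Longrightarrow> \<bar>b y - c0 y\<bar> < \<delta>"
    using Stone_Weierstrass_real_polynomial_function[OF compact_proj2[OF K(1)] cont(2) \<delta>] by blast
  define p where "p = restrict (\<lambda>(x, y). (\<Sum>i\<in>UNIV. c i y * x $ i) + c0 y) K"
  show thesis
  proof (rule that)
    show "p \<in> paff_polys K"
      using c(1) c0(1) unfolding p_def paff_polys_def by blast
    fix z assume "z \<in> K"
    then obtain x y where z: "z = (x, y)" "(x, y) \<in> K" by (cases z) auto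
    then have y: "y \<in> proj2 K" by (auto simp: proj2_def)
    have "\<bar>f z - p z\<bar> = \<bar>(\<Sum>i\<in>UNIV. (a y $ i - c i y) * x $ i) + (b y - c0 y)\<bar>"
      using z by (simp add: ab p_def inner_vec_def sum_subtractf left_diff_distrib)
    also have "\<dots> \<le> (\<Sum>i\<in>UNIV. \<bar>(a y $ i - c i y) * x $ i\<bar>) + \<bar>b y - c0 y\<bar>"
      by (intro order_trans[OF abs_triangle_ineq] add_right_mono sum_abs)
    also have "\<dots> \<le> (\<Sum>i\<in>(UNIV::'n set). \<delta> * R) + \<delta>"
    proof (intro add_mono sum_mono)
      fix i
      show "\<bar>(a y $ i - c i y) * x $ i\<bar> \<le> \<delta> * R"
        unfolding abs_mult using c(2)[OF y] R(2)[OF z(2)] component_le_norm_cart[of x i] \<delta>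
        by (intro mult_mono) (auto intro: less_imp_le)
    qed (use c0(2)[OF y] in simp)
    also have "\<dots> = \<delta> * (CARD('n) * R + 1)"
      by (simp add: algebra_simps)
    also have "\<dots> = \<epsilon>" using pos by (simp add: \<delta>_def)
    finally show "\<bar>f z - p z\<bar> \<le> \<epsilon>" .
  qed
qed

text \<open>The elements of \<open>paff_polys K\<close> are \<open>undefined\<close> outside \<open>K\<close>. Convexity of the fibers keeps
  convex combinations inside \<open>K\<close>, where the polynomial formula is valid.\<close>

lemma paff_polys_subset_paff_continuous:
  fixes K :: "((real ^ 'n) \<times> (real ^ 'm)) set"
  assumes convex: "\<And>y. y \<in> proj2 K \<Longrightarrow> convex (fiber K y)"
  shows "paff_polys K \<subseteq> paff_continuous K"
proof
  fix p assume "p \<in> paff_polys K"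
  then obtain c c0 where p: "p = restrict (\<lambda>(x, y). (\<Sum>i\<in>UNIV. c i y * x $ i) + c0 y) K"
    and c: "\<And>i. real_polynomial_function (c i)" "real_polynomial_function c0"
    by (auto simp: paff_polys_def)
  have cont: "continuous_on K (\<lambda>z. q (snd z))" if "real_polynomial_function q" for q
    by (rule continuous_on_compose2[of UNIV q])
      (auto intro!: continuous_intros continuous_at_imp_continuous_on
        continuous_real_polymonial_function that)
  have "continuous_on K (\<lambda>z. (\<Sum>i\<in>UNIV. c i (snd z) * fst z $ i) + c0 (snd z))"
    by (intro continuous_intros cont c)
  then have "continuous_on K p"
    by (rule continuous_on_eq) (auto simp: p)
  moreover have "affine_on (fiber K y) (\<lambda>x. p (x, y))" if "y \<in> proj2 K" for y
    unfolding affine_on_def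
  proof (intro ballI)
    fix u v and t :: real
    assume uv: "u \<in> fiber K y" "v \<in> fiber K y" and t: "t \<in> {0..1}"
    then have "(1 - t) *\<^sub>R u + t *\<^sub>R v \<in> fiber K y"
      using convex[OF that] by (auto simp: convex_alt)
    with uv have "p ((1 - t) *\<^sub>R u + t *\<^sub>R v, y) =
        (\<Sum>i\<in>UNIV. (1 - t) * (c i y * u $ i) + t * (c i y * v $ i)) + c0 y"
      by (simp add: p fiber_def algebra_simps)
    also have "\<dots> = (1 - t) * p (u, y) + t * p (v, y)"
      using uv by (simp add: p fiber_def sum.distrib flip: sum_distrib_left)
        (simp add: algebra_simps)
    finally show "p ((1 - t) *\<^sub>R u + t *\<^sub>R v, y) = (1 - t) * p (u, y) + t * p (v, y)" .
  qed
  ultimately show "p \<in> paff_continuous K"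
    by (auto simp: paff_continuous_def p)
qed

section \<open>Uniform limits and completeness\<close>

text \<open>The pointwise form of the closure also covers empty \<open>K\<close>, where a supremum over \<open>K\<close> would have
  no meaning.\<close>

lemma closure_of_sup_metric:
  assumes "compact K" "S \<subseteq> mspace (sup_metric K)"
  shows "mtopology_of (sup_metric K) closure_of S =
    {f \<in> mspace (sup_metric K). \<forall>\<epsilon>>0. \<exists>g\<in>S. \<forall>z\<in>K. \<bar>f z - g z\<bar> \<le> \<epsilon>}"
proof -
  interpret M: Metric_space "mspace (sup_metric K)" "mdist (sup_metric K)"
    by (rule Metric_space_mspace_mdist)
  have "mdist (sup_metric K) f g \<le> \<epsilon> \<longleftrightarrow> (\<forall>z\<in>K. \<bar>f z - g z\<bar> \<le> \<epsilon>)"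
    if "f \<in> mspace (sup_metric K)" "g \<in> mspace (sup_metric K)" "\<epsilon> > 0" for f g \<epsilon>
    using that mdist_cfunspace_imp_mdist_le[of f "top_of_set K" euclidean_metric g \<epsilon>]
      mdist_cfunspace_le[of \<epsilon> "top_of_set K" euclidean_metric f g]
    unfolding sup_metric_def by (auto simp: dist_real_def simp del: mspace_cfunspace)
  then show ?thesis
    using assms(2) unfolding mtopology_of_def M.metric_closure_of_alt
    by (auto simp: M.in_mcball subset_iff) metis+
qed

lemma affine_on_limit:
  assumes C: "convex C"
    and appr: "\<And>\<epsilon>. \<epsilon> > 0 \<Longrightarrow> \<exists>g. affine_on C g \<and> (\<forall>x\<in>C. \<bar>f x - g x\<bar> \<le> \<epsilon>)"
  shows "affine_on C f"
  unfolding affine_on_def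
proof (intro ballI)
  fix u v and t :: real
  assume uv: "u \<in> C" "v \<in> C" and t: "t \<in> {0..1}"
  let ?w = "(1 - t) *\<^sub>R u + t *\<^sub>R v"
  have w: "?w \<in> C" using C uv t by (auto simp: convex_alt)
  have "\<bar>f ?w - ((1 - t) * f u + t * f v)\<bar> \<le> 0 + e" if e: "e > 0" for e
  proof -
    obtain g where g: "affine_on C g" "\<And>x. x \<in> C \<Longrightarrow> \<bar>f x - g x\<bar> \<le> e / 2"
      using appr[OF half_gt_zero[OF e]] by blast
    have "g ?w = (1 - t) * g u + t * g v"
      using g(1) uv t unfolding affine_on_def by blast
    then have "f ?w - ((1 - t) * f u + t * f v)
        = (f ?w - g ?w) - ((1 - t) * (f u - g u) + t * (f v - g v))"
      by (simp add: algebra_simps)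
    also have "\<bar>\<dots>\<bar> \<le> \<bar>f ?w - g ?w\<bar> + ((1 - t) * \<bar>f u - g u\<bar> + t * \<bar>f v - g v\<bar>)"
      using t by (intro order_trans[OF abs_triangle_ineq4] add_left_mono
          order_trans[OF abs_triangle_ineq]) (simp add: abs_mult)
    also have "\<dots> \<le> e / 2 + ((1 - t) * (e / 2) + t * (e / 2))"
      using t by (intro add_mono mult_left_mono g(2) uv w) auto
    also have "\<dots> = 0 + e" by (simp add: field_simps)
    finally show ?thesis .
  qed
  then have "\<bar>f ?w - ((1 - t) * f u + t * f v)\<bar> \<le> 0"
    by (rule field_le_epsilon)
  then show "f ?w = (1 - t) * f u + t * f v" by simp
qed

lemma closedin_paff_continuous:
  fixes K :: "((real ^ 'n) \<times> (real ^ 'm)) set"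
  assumes "compact K" and convex: "\<And>y. y \<in> proj2 K \<Longrightarrow> convex (fiber K y)"
  shows "closedin (mtopology_of (sup_metric K)) (paff_continuous K)"
proof -
  have sub: "paff_continuous K \<subseteq> mspace (sup_metric K)"
    by (auto simp: mspace_sup_metric[OF assms(1)] paff_continuous_def)
  have "f \<in> paff_continuous K" if "f \<in> mtopology_of (sup_metric K) closure_of paff_continuous K" for f
  proof -
    have f: "f \<in> extensional K" "continuous_on K f"
      and appr: "\<And>\<epsilon>. \<epsilon> > 0 \<Longrightarrow> \<exists>g\<in>paff_continuous K. \<forall>z\<in>K. \<bar>f z - g z\<bar> \<le> \<epsilon>"
      using that unfolding closure_of_sup_metric[OF assms(1) sub] mspace_sup_metric[OF assms(1)]
      by auto
    have "affine_on (fiber K y) (\<lambda>x. f (x, y))" if y: "y \<in> proj2 K" for y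
    proof (rule affine_on_limit[OF convex[OF y]])
      fix \<epsilon> :: real assume "\<epsilon> > 0"
      from appr[OF this] obtain g where "g \<in> paff_continuous K" "\<forall>z\<in>K. \<bar>f z - g z\<bar> \<le> \<epsilon>"
        by blast
      then show "\<exists>g. affine_on (fiber K y) g \<and> (\<forall>x\<in>fiber K y. \<bar>f (x, y) - g x\<bar> \<le> \<epsilon>)"
        using y by (intro exI[of _ "\<lambda>x. g (x, y)"]) (auto simp: paff_continuous_def fiber_def)
    qed
    with f show ?thesis by (simp add: paff_continuous_def)
  qed
  then show ?thesis
    using sub by (auto simp: closure_of_subset_eq[symmetric])
qed

lemma mcomplete_of_submetric_closed:
  assumes "mcomplete_of m" "closedin (mtopology_of m) S"
  shows "mcomplete_of (submetric m S)"
proof -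
  have S: "S \<subseteq> mspace m" using closedin_subset[OF assms(2)] by simp
  interpret Submetric "mspace m" "mdist m" S
    by (intro Submetric.intro Metric_space_mspace_mdist Submetric_axioms.intro S)
  have "sub.mcomplete"
    using assms by (intro closedin_mcomplete_imp_mcomplete) (auto simp: mcomplete_of_def mtopology_of_def)
  then show ?thesis
    using S by (simp add: mcomplete_of_def Int_absorb2)
qed

theorem proposition3p7:
  fixes K :: "((real ^ 'n) \<times> (real ^ 'm)) set"
  assumes "compact K" and "regular_partially_convex K"
  shows "mtopology_of (sup_metric K) closure_of (paff_polys K) = paff_continuous K \<and>
         mcomplete_of (submetric (sup_metric K) (paff_continuous K))"
proof
  have convex: "convex (fiber K y)" if "y \<in> proj2 K" for y
    using assms(2) that by (simp add: regular_partially_convex_def)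
  have closed: "closedin (mtopology_of (sup_metric K)) (paff_continuous K)"
    using closedin_paff_continuous[OF assms(1)] convex by blast
  have polys: "paff_polys K \<subseteq> paff_continuous K"
    using paff_polys_subset_paff_continuous convex by blast
  have sub: "paff_continuous K \<subseteq> mspace (sup_metric K)"
    using closedin_subset[OF closed] by simp
  show "mtopology_of (sup_metric K) closure_of (paff_polys K) = paff_continuous K"
  proof (rule subset_antisym)
    show "mtopology_of (sup_metric K) closure_of (paff_polys K) \<subseteq> paff_continuous K"
      by (rule closure_of_minimal[OF polys closed])
    show "paff_continuous K \<subseteq> mtopology_of (sup_metric K) closure_of (paff_polys K)"
    proof
      fix f assume f: "f \<in> paff_continuous K"
      have "\<exists>p\<in>paff_polys K. \<forall>z\<in>K. \<bar>f z - p z\<bar> \<le> \<epsilon>" if "\<epsilon> > 0" for \<epsilon>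
        using paff_polys_dense[OF assms f that] by metis
      then show "f \<in> mtopology_of (sup_metric K) closure_of (paff_polys K)"
        using f sub unfolding closure_of_sup_metric[OF assms(1) order_trans[OF polys sub]] by blast
    qed
  qed
  have "mcomplete_of (sup_metric K)"
    unfolding sup_metric_def euclidean_metric_def
    by (rule Met_TC.mcomplete_cfunspace[unfolded Met_TC.Self_def]) (simp add: complete_UNIV)
  then show "mcomplete_of (submetric (sup_metric K) (paff_continuous K))"
    by (rule mcomplete_of_submetric_closed[OF _ closed])
qed

end
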